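(* Let $N, d\in\mathbb{N}^*$ and let $w : (\mathbb{R}^d)^N\to\mathbb{R}$ be an exchangeable and differentiable function. Then there exists a $D$-exchangeable function $\mathrm{z} : (\mathbb{R}^d)^N\times\mathbb{R}^d\to\mathbb{R}^d$ such that $$D_{x_i} w(x) = \mathrm{z}(x,x_i), \qquad i=1,\ldots,N,$$ for all $x=(x_i)_{1\le i\le N}\in(\mathbb{R}^d)^N$; that is, $Dw(x) = (\mathrm{z}(x,x_i))_{1\le i\le N}$ for all $x \in (\mathbb{R}^d)^N$.
   Context: For $x=(x_i)_{1\le i\le N}\in(\mathbb{R}^d)^N$ and a permutation $\pi$ of $\{1,\ldots,N\}$, $\pi[x] := (x_{\pi(i)})_{1\le i\le N}$. A function $\varphi$ on $(\mathbb{R}^d)^N$ is exchangeable if $\varphi(x)=\varphi(\pi[x])$ for all $x\in(\mathbb{R}^d)^N$ and all permutations $\pi$ of $\{1,\ldots,N\}$. A function $(x,\xi)\in(\mathbb{R}^d)^N\times\mathbb{R}^d\mapsto \mathrm{z}(x,\xi)$ is $D$-exchangeable if for every fixed $\xi\in\mathbb{R}^d$ the function $\mathrm{z}(\cdot,\xi)$ is exchangeable on $(\mathbb{R}^d)^N$. For a differentiable $w:(\mathbb{R}^d)^N\to\mathbb{R}$, $D_{x_i}w(x)\in\mathbb{R}^d$ denotes the gradient with respect to the $i$-th variable $x_i\in\mathbb{R}^d$, and $Dw(x)=(D_{x_i}w(x))_{1\le i\le N}\in(\mathbb{R}^d)^N$. *)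

theory Defs
  imports "HOL-Analysis.Analysis"
begin

text \<open>
  A point of \<open>(\<real>\<^sup>d)\<^sup>N\<close> is an \<open>x :: (real ^ 'd) ^ 'N\<close> with \<open>d = CARD('d)\<close>, \<open>N = CARD('N)\<close>;
  \<open>x $ i\<close> is the \<open>i\<close>-th variable, a vector in \<open>\<real>\<^sup>d\<close>.
\<close>

definition permute_vars :: "('N \<Rightarrow> 'N) \<Rightarrow> 'a ^ 'N \<Rightarrow> 'a ^ 'N" where
  "permute_vars p x = (\<chi> i. x $ p i)"

definition exchangeable :: "((real ^ 'd) ^ 'N \<Rightarrow> 'b) \<Rightarrow> bool" where
  "exchangeable f \<longleftrightarrow> (\<forall>x p. p permutes UNIV \<longrightarrow> f x = f (permute_vars p x))"

definition D_exchangeable :: "(((real ^ 'd) ^ 'N) \<times> (real ^ 'd) \<Rightarrow> 'b) \<Rightarrow> bool" where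
  "D_exchangeable z \<longleftrightarrow> (\<forall>\<xi>. exchangeable (\<lambda>x. z (x, \<xi>)))"

definition subst_var :: "'a ^ 'N \<Rightarrow> 'N \<Rightarrow> 'a \<Rightarrow> 'a ^ 'N" where
  "subst_var x i y = (\<chi> j. if j = i then y else x $ j)"

text \<open>
  The gradient with respect to the \<open>i\<close>-th variable only, the others being frozen at \<open>x\<close>.  The
  gradient at a point is unique if it exists, so the description is meaningful
  for differentiable \<open>w\<close>.
\<close>

definition partial_gradient :: "((real ^ 'd) ^ 'N \<Rightarrow> real) \<Rightarrow> 'N \<Rightarrow> (real ^ 'd) ^ 'N \<Rightarrow> real ^ 'd" where
  "partial_gradient w i x = (THE g. GDERIV (\<lambda>y. w (subst_var x i y)) (x $ i) :> g)"

definition full_gradient :: "((real ^ 'd) ^ 'N \<Rightarrow> real) \<Rightarrow> (real ^ 'd) ^ 'N \<Rightarrow> (real ^ 'd) ^ 'N" where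
  "full_gradient w x = (\<chi> i. partial_gradient w i x)"

end

theory Submission
  imports Defs
begin

text \<open>
  Relabelling the variables of an exchangeable \<open>w\<close> relabels its partial gradients in the same
  way (\<open>partial_gradient_permute_vars\<close>).  Applied to the transposition of two indices \<open>i\<close>, \<open>j\<close>
  with \<open>x $ i = x $ j\<close>, which fixes \<open>x\<close>, this says that the gradients with respect to the \<open>i\<close>-th
  and the \<open>j\<close>-th variable agree at \<open>x\<close> (\<open>partial_gradient_eq_if_same_value\<close>).  So the gradient
  with respect to a variable is determined by \<open>x\<close> and the value of that variable, and \<open>z (x, \<xi>)\<close>
  can be taken to be the common gradient at all the indices \<open>i\<close> with \<open>x $ i = \<xi>\<close>.  Permuting
  \<open>x\<close> only reindexes this set of gradients, hence \<open>z\<close> is \<open>D\<close>-exchangeable.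
\<close>

lemma subst_var_permute_vars:
  assumes "p permutes UNIV"
  shows "subst_var (permute_vars p x) i y = permute_vars p (subst_var x (p i) y)"
  using permutes_inj[OF assms]
  by (auto simp: subst_var_def permute_vars_def vec_eq_iff inj_eq)

text \<open>
  Moving the \<open>i\<close>-th variable of the permuted point is moving the \<open>p i\<close>-th variable of \<open>x\<close> and
  permuting afterwards, which \<open>w\<close> does not see: both gradients are those of the same function of
  one variable, at the same point.
\<close>

lemma partial_gradient_permute_vars:
  assumes "exchangeable w" and p: "p permutes UNIV"
  shows "partial_gradient w i (permute_vars p x) = partial_gradient w (p i) x"
proof -
  have "w (subst_var (permute_vars p x) i y) = w (subst_var x (p i) y)" for y
    using assms by (metis exchangeable_def subst_var_permute_vars)
  moreover have "permute_vars p x $ i = x $ p i"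
    by (simp add: permute_vars_def)
  ultimately show ?thesis
    by (simp add: partial_gradient_def)
qed

lemma partial_gradient_eq_if_same_value:
  assumes "exchangeable w" and "x $ i = x $ j"
  shows "partial_gradient w i x = partial_gradient w j x"
proof -
  have "permute_vars (Transposition.transpose i j) x = x"
    using assms(2) by (auto simp: permute_vars_def vec_eq_iff Transposition.transpose_def)
  moreover have "Transposition.transpose i j permutes UNIV"
    by (simp add: permutes_swap_id)
  ultimately show ?thesis
    using partial_gradient_permute_vars[OF assms(1), of "Transposition.transpose i j" i x] by simp
qed

theorem lemma2p5:
  fixes w :: "(real ^ 'd) ^ 'N \<Rightarrow> real"
  assumes "exchangeable w"
    and "\<And>x. w differentiable (at x)"
  shows "\<exists>z :: ((real ^ 'd) ^ 'N) \<times> (real ^ 'd) \<Rightarrow> real ^ 'd.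
           D_exchangeable z \<and>
           (\<forall>x i. partial_gradient w i x = z (x, x $ i)) \<and>
           (\<forall>x. full_gradient w x = (\<chi> i. z (x, x $ i)))"
proof -
  define G where "G = (\<lambda>x \<xi>. {partial_gradient w i x | i. x $ i = \<xi>})"
  \<comment> \<open>When \<open>\<xi>\<close> is not among the variables of \<open>x\<close>, the choice from the empty set is a constant
    independent of \<open>x\<close>, which is exchangeable as well.\<close>
  define z where "z = (\<lambda>(x, \<xi>). SOME g. g \<in> G x \<xi>)"
  have "G (permute_vars p x) \<xi> = G x \<xi>" if p: "p permutes UNIV" for p x \<xi>
  proof -
    have "G (permute_vars p x) \<xi> = {partial_gradient w (p i) x | i. x $ p i = \<xi>}"
      by (simp add: G_def partial_gradient_permute_vars[OF assms(1) p])
        (simp add: permute_vars_def)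
    also have "\<dots> = G x \<xi>"
      unfolding G_def using permutes_surj[OF p] by (metis surjD)
    finally show ?thesis .
  qed
  then have "D_exchangeable z"
    by (simp add: D_exchangeable_def exchangeable_def z_def)
  moreover have gradient: "partial_gradient w i x = z (x, x $ i)" for x i
  proof -
    have "G x (x $ i) = {partial_gradient w i x}"
      unfolding G_def using partial_gradient_eq_if_same_value[OF assms(1)] by blast
    then show ?thesis
      by (simp add: z_def)
  qed
  moreover have "full_gradient w x = (\<chi> i. z (x, x $ i))" for x
    by (simp add: full_gradient_def gradient)
  ultimately show ?thesis
    by blast
qed

end
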